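(* Let $0<\tau\le1$. Assume that $\Phi$ has the $\tau$-Null Space Property of order $K$ with constant $\gamma\in(0,1)$ and that $\mathcal{F}(y)$ contains a $k$-sparse vector $x^*$ with $k\le K$ and $r(x^* )_k>0$ (here $K$ is the same index as in the update rule for $\epsilon_n$ in the algorithm described in the context). Let $(x^n)$ be the sequence produced by that algorithm and put $E_n:=\|x^n-x^*\|_{\ell_\tau}^\tau$. Suppose that, for a given $0<\rho<1$ and some $n_0$, we have $$E_{n_0}\le R^*:=\left[\rho\,r(x^* )_k\right]^\tau,$$ and define $$\mu:=2^{1-\tau}\gamma(1+\gamma)A^\tau\left(1+\left(\frac{N^{1-\tau}}{K+1-k}\right)^{2-\tau}\right),\qquad A:=\left(r(x^* )_k^{1-\tau}(1-\rho)^{2-\tau}\right)^{-1}.$$ If $\rho$ and $\gamma$ are sufficiently small so that $$\mu(R^* )^{1-\tau}=\mu\,\rho^{\tau(1-\tau)}r(x^* )_k^{\tau(1-\tau)}\le1,$$ then for all $n\ge n_0$ we have $$E_{n+1}\le\mu\,E_n^{2-\tau}.$$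
   Context: Setting: $m<N$ are positive integers, $\Phi$ is a real $m\times N$ matrix of full rank $m$, $y\in\mathbb{R}^m$, $\mathcal{N}:=\ker\Phi\subset\mathbb{R}^N$, $\mathcal{F}(y):=\{z\in\mathbb{R}^N:\Phi z=y\}$. $K,k$ are positive integers; $n_0\ge1$. For $0<\tau\le1$, $\|z\|_{\ell_\tau}^\tau:=\sum_{i=1}^N|z_i|^\tau$. A vector is $k$-sparse if it has at most $k$ nonzero coordinates. For $z\in\mathbb{R}^N$, $r(z)_i$ is the $i$-th largest of the numbers $|z_1|,\dots,|z_N|$ (counted with multiplicity). $\tau$-Null Space Property ($\tau$-NSP): $\Phi$ has the $\tau$-NSP of order $K$ with constant $\gamma>0$ if $\|\eta_T\|_{\ell_\tau}^\tau\le\gamma\|\eta_{T^c}\|_{\ell_\tau}^\tau$ for all $\eta\in\mathcal{N}$ and all $T\subset\{1,\dots,N\}$ with $\#T\le K$; here $\eta_S$ is obtained from $\eta$ by setting to zero all coordinates with index not in $S$. IRLS algorithm for $\ell_\tau$: set $w^0:=(1,\dots,1)$, $\epsilon_0:=1$. For $n=0,1,2,\dots$ define $$x^{n+1}:=\arg\min_{z\in\mathcal{F}(y)}\sum_{j=1}^N w^n_j z_j^2,\qquad \epsilon_{n+1}:=\min\Big(\epsilon_n,\frac{r(x^{n+1})_{K+1}}{N}\Big),\qquad w^{n+1}_j:=\big[(x^{n+1}_j)^2+\epsilon_{n+1}^2\big]^{-\frac{2-\tau}{2}}.$$ If $\epsilon_n=0$ the algorithm stops and one sets $x^j:=x^n$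 for $j>n$. *)

theory Defs
  imports "HOL-Analysis.Analysis" "HOL-Library.Multiset"
begin

definition feasible_set :: "real^'n^'m \<Rightarrow> real^'m \<Rightarrow> (real^'n) set" where
  "feasible_set \<Phi> y = {z. \<Phi> *v z = y}"

definition null_space :: "real^'n^'m \<Rightarrow> (real^'n) set" where
  "null_space \<Phi> = {\<eta>. \<Phi> *v \<eta> = 0}"

text \<open>The \<open>\<tau>\<close>-th power of the \<open>\<tau>\<close>-(quasi-)norm. It is only used for \<open>\<tau> > 0\<close>, where
  \<open>0 powr \<tau> = 0\<close> is the intended value.\<close>

definition ltau_pow :: "real \<Rightarrow> real^'n \<Rightarrow> real" where
  "ltau_pow \<tau> z = (\<Sum>i\<in>UNIV. \<bar>z $ i\<bar> powr \<tau>)"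

definition restrict_vec :: "'n set \<Rightarrow> real^'n \<Rightarrow> real^'n" where
  "restrict_vec S z = (\<chi> i. if i \<in> S then z $ i else 0)"

definition k_sparse :: "nat \<Rightarrow> real^'n \<Rightarrow> bool" where
  "k_sparse k z \<longleftrightarrow> card {i. z $ i \<noteq> 0} \<le> k"

text \<open>The \<open>i\<close>-th largest absolute value of an entry, counted with multiplicity. Indices start
  at 1; the value is meaningful for \<open>1 \<le> i \<le> CARD('n)\<close> only.\<close>

definition rearr :: "real^'n \<Rightarrow> nat \<Rightarrow> real" where
  "rearr z i = rev (sorted_list_of_multiset (image_mset (\<lambda>j. \<bar>z $ j\<bar>) (mset_set UNIV))) ! (i - 1)"

definition tau_NSP :: "real \<Rightarrow> real^'n^'m \<Rightarrow> nat \<Rightarrow> real \<Rightarrow> bool" where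
  "tau_NSP \<tau> \<Phi> K \<gamma> \<longleftrightarrow> \<gamma> > 0 \<and>
     (\<forall>\<eta>\<in>null_space \<Phi>. \<forall>T. card T \<le> K \<longrightarrow>
        ltau_pow \<tau> (restrict_vec T \<eta>) \<le> \<gamma> * ltau_pow \<tau> (restrict_vec (- T) \<eta>))"

text \<open>The state \<open>(x\<^sup>n, \<epsilon>\<^sub>n, w\<^sup>n)\<close> of the algorithm. There is no \<open>x\<^sup>0\<close>, so the first component of
  the initial state is left unspecified; no later state depends on it. As long as \<open>\<epsilon>\<^sub>n > 0\<close> all
  weights are positive, so the minimizer exists and is unique whenever the feasible set is
  nonempty. Once \<open>\<epsilon>\<^sub>n = 0\<close> the state is frozen, so the weights computed from \<open>\<epsilon>\<^sub>n = 0\<close> (where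
  \<open>powr\<close> would give \<open>0\<close> instead of \<open>\<infinity>\<close> for vanishing entries) are never used.\<close>

fun irls_state :: "real^'n^'m \<Rightarrow> real^'m \<Rightarrow> nat \<Rightarrow> real \<Rightarrow> nat \<Rightarrow> (real^'n) \<times> real \<times> (real^'n)" where
  "irls_state \<Phi> y K \<tau> 0 = (undefined, 1, (\<chi> j. 1))"
| "irls_state \<Phi> y K \<tau> (Suc n) =
    (let (x, \<epsilon>, w) = irls_state \<Phi> y K \<tau> n in
     if \<epsilon> = 0 then (x, \<epsilon>, w)
     else
       let x' = arg_min (\<lambda>z. \<Sum>j\<in>UNIV. w $ j * (z $ j)\<^sup>2) (\<lambda>z. z \<in> feasible_set \<Phi> y);
           \<epsilon>' = min \<epsilon> (rearr x' (K + 1) / real CARD('n));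
           w' = (\<chi> j. ((x' $ j)\<^sup>2 + \<epsilon>'\<^sup>2) powr (- ((2 - \<tau>) / 2)))
       in (x', \<epsilon>', w'))"

definition irls :: "real^'n^'m \<Rightarrow> real^'m \<Rightarrow> nat \<Rightarrow> real \<Rightarrow> nat \<Rightarrow> real^'n" where
  "irls \<Phi> y K \<tau> n = fst (irls_state \<Phi> y K \<tau> n)"

end

theory Submission imports Defs
begin

text \<open>Write \<open>\<eta> = x\<^sup>n\<^sup>+\<^sup>1 - x\<^sup>*\<close> and let \<open>T\<close> be the support of \<open>x\<^sup>*\<close>. The iterate
  \<open>x\<^sup>n\<^sup>+\<^sup>1\<close> minimises a weighted quadratic form over an affine space, hence is orthogonal, in the
  weighted inner product, to the kernel of \<open>\<Phi>\<close> and in particular to \<open>\<eta>\<close>. Consequently the weighted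
  energy \<open>\<Sum> w\<^sub>j \<eta>\<^sub>j\<^sup>2\<close> equals a sum over \<open>T\<close> only. Near \<open>x\<^sup>*\<close> the weights on \<open>T\<close> are
  bounded (\<open>weight_mult_entry_le\<close>), so this energy is at most \<open>A\<close> times the 1-norm of \<open>\<eta>\<close> on \<open>T\<close>,
  and the null space property moves that quantity to the complement of \<open>T\<close>.

  Off \<open>T\<close> the weights are large: the inverse weight at \<open>j\<close> is a power of
  \<open>(x\<^sup>n\<^sub>j)\<^sup>2 + \<epsilon>\<^sub>n\<^sup>2\<close>, where \<open>x\<^sup>n\<^sub>j\<close> is itself an error term since \<open>x\<^sup>*\<^sub>j = 0\<close>, and \<open>\<epsilon>\<^sub>n\<close>
  is dominated by the error because \<open>x\<^sup>*\<close> is sparse (\<open>regularised_off_support_le\<close>). Hoelder's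
  inequality combines this with the energy bound and produces the exponent \<open>2 - \<tau>\<close>
  (\<open>reweighted_off_support_le\<close>); the resulting one-step estimate is \<open>reweighted_step_error_le\<close>.

  If the algorithm has stopped, the iterate is \<open>K\<close>-sparse and feasible, and the null space property
  leaves room for just one such vector (\<open>tau_NSP_sparse_unique\<close>), so the error is zero. Finally, the
  smallness condition on \<open>\<mu>\<close> makes the one-step estimate non-expanding on the ball of radius
  \<open>R\<^sup>*\<close>, so that the iterates stay in the region where the estimate is valid.\<close>

section \<open>Inequalities for real powers\<close>

text \<open>Subadditivity holds because the shares \<open>a / (a + b)\<close> and \<open>b / (a + b)\<close> sum to 1 and each
  share, being at most 1, only grows when raised to the power \<open>p\<close>.\<close>

lemma powr_add_le:
  fixes a b p :: real
  assumes "0 \<le> a" "0 \<le> b" "0 < p" "p \<le> 1"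
  shows "(a + b) powr p \<le> a powr p + b powr p"
proof (cases "a + b = 0")
  case True
  then show ?thesis using assms by simp
next
  case False
  define s where "s = a + b"
  have s: "s > 0" using False assms by (simp add: s_def)
  have frac: "t / s * s powr p \<le> t powr p" if "0 \<le> t" "t \<le> s" for t
  proof (cases "t = 0")
    case False
    have "(t / s) powr 1 \<le> (t / s) powr p"
      using that s False assms by (intro powr_mono') auto
    then have "t / s * s powr p \<le> (t / s) powr p * s powr p"
      using that s by (intro mult_right_mono) auto
    also have "\<dots> = t powr p"
      using that s by (simp flip: powr_mult)
    finally show ?thesis .
  qed simp
  have "s powr p = a / s * s powr p + b / s * s powr p"
    using s by (simp add: s_def flip: distrib_right add_divide_distrib)
  also have "\<dots> \<le> a powr p + b powr p"
    using assms by (intro add_mono frac) (auto simp: s_def)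
  finally show ?thesis by (simp add: s_def)
qed

lemma abs_powr_triangle:
  fixes a b p :: real
  assumes "0 < p" "p \<le> 1"
  shows "\<bar>a + b\<bar> powr p \<le> \<bar>a\<bar> powr p + \<bar>b\<bar> powr p"
proof -
  have "\<bar>a + b\<bar> powr p \<le> (\<bar>a\<bar> + \<bar>b\<bar>) powr p"
    using assms by (intro powr_mono2) auto
  also have "\<dots> \<le> \<bar>a\<bar> powr p + \<bar>b\<bar> powr p"
    using assms by (intro powr_add_le) auto
  finally show ?thesis .
qed

lemma sum_powr_le:
  fixes f :: "'a \<Rightarrow> real"
  assumes "finite S" "\<And>i. i \<in> S \<Longrightarrow> 0 \<le> f i" "0 < p" "p \<le> 1"
  shows "(\<Sum>i\<in>S. f i) powr p \<le> (\<Sum>i\<in>S. f i powr p)"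
  using assms
proof (induction S rule: finite_induct)
  case (insert a S)
  have "(f a + sum f S) powr p \<le> f a powr p + sum f S powr p"
    using insert.prems by (intro powr_add_le) (auto intro: sum_nonneg)
  also have "\<dots> \<le> f a powr p + (\<Sum>i\<in>S. f i powr p)"
    using insert by simp
  finally show ?case using insert.hyps by simp
qed simp

lemma add_powr_le_convex:
  fixes a b q :: real
  assumes "0 \<le> a" "0 \<le> b" "1 \<le> q"
  shows "(a + b) powr q \<le> 2 powr (q - 1) * (a powr q + b powr q)"
proof (cases "a = 0 \<or> b = 0")
  case True
  have "1 * t powr q \<le> 2 powr (q - 1) * t powr q" for t :: real
    using assms by (intro mult_right_mono ge_one_powr_ge_zero) auto
  then show ?thesis using True assms by auto
next
  case False
  then have "(\<lambda>x. x powr q) ((1 - 1/2) *\<^sub>R a + (1/2) *\<^sub>R b)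
      \<le> (1 - 1/2) * a powr q + (1/2) * b powr q"
    using assms by (intro convex_onD[OF powr_convex]) auto
  then have "((a + b) / 2) powr q \<le> (a powr q + b powr q) / 2"
    by (simp add: add_divide_distrib)
  moreover have "((a + b) / 2) powr q = (a + b) powr q / (2 * 2 powr (q - 1))"
    using assms by (simp add: powr_divide powr_diff)
  ultimately show ?thesis
    by (simp add: field_simps)
qed

lemma square_powr_half: "(t\<^sup>2) powr (p / 2) = \<bar>t\<bar> powr p" for t p :: real
proof -
  have "t\<^sup>2 = \<bar>t\<bar> powr 2" by simp
  then show ?thesis by (simp only: powr_powr) simp
qed

text \<open>Hoelder's inequality for the conjugate exponents \<open>1/\<alpha>\<close> and \<open>1/(1 - \<alpha>)\<close>: after
  normalising both sums to 1, add up Young's inequality.\<close>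

lemma Hoelder_powr_sum:
  fixes a b :: "'a \<Rightarrow> real"
  assumes fin: "finite S" and a: "\<And>i. i \<in> S \<Longrightarrow> 0 \<le> a i" and b: "\<And>i. i \<in> S \<Longrightarrow> 0 \<le> b i"
    and \<alpha>: "0 < \<alpha>" "\<alpha> < 1"
  shows "(\<Sum>i\<in>S. a i powr \<alpha> * b i powr (1 - \<alpha>))
    \<le> (\<Sum>i\<in>S. a i) powr \<alpha> * (\<Sum>i\<in>S. b i) powr (1 - \<alpha>)"
proof (cases "sum a S = 0 \<or> sum b S = 0")
  case True
  then have "(\<forall>i\<in>S. a i = 0) \<or> (\<forall>i\<in>S. b i = 0)"
    using fin a b by (auto simp: sum_nonneg_eq_0_iff)
  then show ?thesis by (elim disjE) auto
next
  case False
  define P Q where "P = sum a S" and "Q = sum b S"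
  have PQ: "P > 0" "Q > 0"
    using False a b by (auto simp: P_def Q_def order.strict_iff_order sum_nonneg)
  have "a i powr \<alpha> * b i powr (1 - \<alpha>)
      \<le> P powr \<alpha> * Q powr (1 - \<alpha>) * (\<alpha> * (a i / P) + (1 - \<alpha>) * (b i / Q))" if "i \<in> S" for i
  proof (cases "a i = 0 \<or> b i = 0")
    case True
    have "0 \<le> P powr \<alpha> * Q powr (1 - \<alpha>) * (\<alpha> * (a i / P) + (1 - \<alpha>) * (b i / Q))"
      using PQ a b that \<alpha> by (intro mult_nonneg_nonneg add_nonneg_nonneg) auto
    then show ?thesis using True by auto
  next
    case False
    then have pos: "a i > 0" "b i > 0" using a b that by (auto simp: order.strict_iff_order)
    have "(a i / P) powr \<alpha> * (b i / Q) powr (1 - \<alpha>) \<le> \<alpha> * (a i / P) + (1 - \<alpha>) * (b i / Q)"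
      using pos PQ \<alpha> by (intro Youngs_inequality_0) auto
    then have "P powr \<alpha> * Q powr (1 - \<alpha>) * ((a i / P) powr \<alpha> * (b i / Q) powr (1 - \<alpha>))
      \<le> P powr \<alpha> * Q powr (1 - \<alpha>) * (\<alpha> * (a i / P) + (1 - \<alpha>) * (b i / Q))"
      by (intro mult_left_mono) auto
    moreover have "P powr \<alpha> * Q powr (1 - \<alpha>) * ((a i / P) powr \<alpha> * (b i / Q) powr (1 - \<alpha>))
        = a i powr \<alpha> * b i powr (1 - \<alpha>)"
      using pos PQ by (simp add: powr_divide)
    ultimately show ?thesis by simp
  qed
  then have "(\<Sum>i\<in>S. a i powr \<alpha> * b i powr (1 - \<alpha>))
      \<le> (\<Sum>i\<in>S. P powr \<alpha> * Q powr (1 - \<alpha>) * (\<alpha> * (a i / P) + (1 - \<alpha>) * (b i / Q)))"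
    by (rule sum_mono)
  also have "\<dots> = P powr \<alpha> * Q powr (1 - \<alpha>) * (\<alpha> * (P / P) + (1 - \<alpha>) * (Q / Q))"
    by (simp add: P_def Q_def sum.distrib flip: sum_distrib_left sum_divide_distrib)
  finally show ?thesis using PQ by (simp add: P_def Q_def)
qed

section \<open>The decreasing rearrangement\<close>

text \<open>The decreasing list behind \<open>rearr\<close> has the same entries as \<open>z\<close>, so counting coordinates
  becomes counting list positions.\<close>

lemma card_filter_rearr_list:
  fixes z :: "real^'n"
  defines "xs \<equiv> rev (sorted_list_of_multiset (image_mset (\<lambda>j. \<bar>z $ j\<bar>) (mset_set UNIV)))"
  shows "card {j. P \<bar>z $ j\<bar>} = card {i. i < CARD('n) \<and> P (xs ! i)}" and "length xs = CARD('n)"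
proof -
  let ?M = "image_mset (\<lambda>j. \<bar>z $ j\<bar>) (mset_set (UNIV :: 'n set))"
  have M: "mset xs = ?M" by (simp add: xs_def)
  show len: "length xs = CARD('n)" using arg_cong[OF M, of size] by simp
  have "card {j. P \<bar>z $ j\<bar>} = size (filter_mset P ?M)"
    by (simp add: filter_mset_image_mset)
  also have "\<dots> = length (filter P xs)"
    by (simp flip: M mset_filter)
  also have "\<dots> = card {i. i < CARD('n) \<and> P (xs ! i)}"
    by (simp add: length_filter_conv_card len)
  finally show "card {j. P \<bar>z $ j\<bar>} = card {i. i < CARD('n) \<and> P (xs ! i)}" .
qed

lemma
  fixes z :: "real^'n"
  assumes "1 \<le> i" "i \<le> CARD('n)"
  shows card_ge_rearr: "i \<le> card {j. rearr z i \<le> \<bar>z $ j\<bar>}"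
    and card_gt_rearr: "card {j. rearr z i < \<bar>z $ j\<bar>} < i"
    and rearr_nonneg: "0 \<le> rearr z i"
proof -
  define xs where "xs = rev (sorted_list_of_multiset (image_mset (\<lambda>j. \<bar>z $ j\<bar>) (mset_set (UNIV :: 'n set))))"
  have r: "rearr z i = xs ! (i - 1)" by (simp add: rearr_def xs_def)
  have len: "length xs = CARD('n)" unfolding xs_def by (rule card_filter_rearr_list)
  have "sorted (rev xs)" by (simp add: xs_def)
  then have dec: "xs ! b \<le> xs ! a" if "a \<le> b" "b < CARD('n)" for a b
    using that len by (simp add: sorted_rev_nth_mono)
  have "card {..<i} \<le> card {l. l < CARD('n) \<and> rearr z i \<le> xs ! l}"
    using assms by (intro card_mono) (auto simp: r intro!: dec)
  then show "i \<le> card {j. rearr z i \<le> \<bar>z $ j\<bar>}"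
    using card_filter_rearr_list(1)[of "\<lambda>t. rearr z i \<le> t" z] by (simp add: xs_def)
  have "{l. l < CARD('n) \<and> rearr z i < xs ! l} \<subseteq> {..<i - 1}"
    using dec[of "i - 1"] by (force simp: r not_less[symmetric])
  from card_mono[OF _ this] show "card {j. rearr z i < \<bar>z $ j\<bar>} < i"
    using card_filter_rearr_list(1)[of "\<lambda>t. rearr z i < t" z] assms by (simp add: xs_def)
  have "xs ! (i - 1) \<in> set xs" using len assms by (intro nth_mem) auto
  then show "0 \<le> rearr z i" by (auto simp: r xs_def)
qed

lemma k_sparse_if_rearr_Suc_eq_0:
  fixes z :: "real^'n"
  assumes "K < CARD('n)" "rearr z (K + 1) = 0"
  shows "k_sparse K z"
  using card_gt_rearr[of "K + 1" z] assms by (simp add: k_sparse_def)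

text \<open>At least \<open>k\<close> entries reach \<open>rearr z k\<close>, all of them in the support when that value is
  positive; as the support has no more than \<open>k\<close> elements, these are all of it.\<close>

lemma sparse_entries_ge_rearr:
  fixes z :: "real^'n"
  assumes "k_sparse k z" "0 < rearr z k" "1 \<le> k" "k \<le> CARD('n)" "z $ i \<noteq> 0"
  shows "rearr z k \<le> \<bar>z $ i\<bar>"
proof -
  have "{j. rearr z k \<le> \<bar>z $ j\<bar>} = {j. z $ j \<noteq> 0}"
    using card_ge_rearr[of k z] assms by (intro card_seteq) (auto simp: k_sparse_def)
  then show ?thesis using assms by auto
qed

text \<open>At least \<open>K + 1 - k\<close> of the \<open>K + 1\<close> largest entries of \<open>v\<close> lie outside the support
  of \<open>z\<close>, and there \<open>v\<close> coincides with \<open>v - z\<close>.\<close>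

lemma rearr_powr_le_ltau_pow_diff:
  fixes v z :: "real^'n"
  assumes "k_sparse k z" "k \<le> K" "K < CARD('n)" "0 < \<tau>"
  shows "(real K + 1 - real k) * rearr v (K + 1) powr \<tau> \<le> ltau_pow \<tau> (v - z)"
proof -
  define J where "J = {j. rearr v (K + 1) \<le> \<bar>v $ j\<bar>} - {j. z $ j \<noteq> 0}"
  have "K + 1 - k \<le> card {j. rearr v (K + 1) \<le> \<bar>v $ j\<bar>} - card {j. z $ j \<noteq> 0}"
    using card_ge_rearr[of "K + 1" v] assms by (simp add: k_sparse_def)
  also have "\<dots> \<le> card J"
    unfolding J_def by (intro diff_card_le_card_Diff) simp
  finally have "real K + 1 - real k \<le> real (card J)"
    using assms by linarith
  then have "(real K + 1 - real k) * rearr v (K + 1) powr \<tau> \<le> (\<Sum>j\<in>J. rearr v (K + 1) powr \<tau>)"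
    by (simp add: mult_right_mono)
  also have "\<dots> \<le> (\<Sum>j\<in>J. \<bar>(v - z) $ j\<bar> powr \<tau>)"
    using assms rearr_nonneg[of "K + 1" v]
    by (intro sum_mono powr_mono2) (auto simp: J_def)
  also have "\<dots> \<le> ltau_pow \<tau> (v - z)"
    unfolding ltau_pow_def by (intro sum_mono2) auto
  finally show ?thesis .
qed

section \<open>Consequences of the null space property\<close>

lemma ltau_pow_nonneg: "0 \<le> ltau_pow \<tau> z"
  by (simp add: ltau_pow_def sum_nonneg)

lemma ltau_pow_0: "ltau_pow \<tau> 0 = 0"
  by (simp add: ltau_pow_def)

lemma ltau_pow_restrict_vec: "ltau_pow \<tau> (restrict_vec S z) = (\<Sum>i\<in>S. \<bar>z $ i\<bar> powr \<tau>)"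
proof -
  have "ltau_pow \<tau> (restrict_vec S z) = (\<Sum>i\<in>UNIV. if i \<in> S then \<bar>z $ i\<bar> powr \<tau> else 0)"
    unfolding ltau_pow_def restrict_vec_def by (intro sum.cong) auto
  then show ?thesis by (simp add: sum.If_cases)
qed

lemma ltau_pow_split:
  "ltau_pow \<tau> z = (\<Sum>i\<in>S. \<bar>z $ i\<bar> powr \<tau>) + (\<Sum>i\<in>-S. \<bar>z $ i\<bar> powr \<tau>)"
  unfolding ltau_pow_def by (subst sum.union_disjoint[symmetric]) auto

lemma abs_entry_powr_le_ltau_pow: "\<bar>z $ i\<bar> powr \<tau> \<le> ltau_pow \<tau> z"
  unfolding ltau_pow_def by (rule member_le_sum) auto

lemma tau_NSP_sum_le:
  assumes "tau_NSP \<tau> \<Phi> K \<gamma>" "\<eta> \<in> null_space \<Phi>" "card T \<le> K"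
  shows "(\<Sum>i\<in>T. \<bar>\<eta> $ i\<bar> powr \<tau>) \<le> \<gamma> * (\<Sum>i\<in>-T. \<bar>\<eta> $ i\<bar> powr \<tau>)"
  using assms unfolding tau_NSP_def ltau_pow_restrict_vec by blast

text \<open>With \<open>T\<close> the whole index set, the null space property would force the kernel to be
  trivial, which it is not for dimension reasons.\<close>

lemma tau_NSP_order_less:
  fixes \<Phi> :: "real^'n^'m"
  assumes "CARD('m) < CARD('n)" "tau_NSP \<tau> \<Phi> K \<gamma>"
  shows "K < CARD('n)"
proof (rule ccontr)
  assume "\<not> K < CARD('n)"
  have "\<not> inj ((*v) \<Phi>)"
    using assms(1) linear_injective_imp_surjective rank_bound[of \<Phi>]
    by (auto simp: full_rank_injective[symmetric])
  then obtain \<eta> where \<eta>: "\<Phi> *v \<eta> = 0" "\<eta> \<noteq> 0"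
    by (metis matrix_left_invertible_injective matrix_left_invertible_ker)
  then obtain i where i: "\<eta> $ i \<noteq> 0" by (auto simp: vec_eq_iff)
  have "ltau_pow \<tau> \<eta> \<le> \<gamma> * 0"
    using tau_NSP_sum_le[OF assms(2), of \<eta> UNIV] \<eta> \<open>\<not> K < CARD('n)\<close>
    by (simp add: null_space_def ltau_pow_def)
  moreover have "0 < \<bar>\<eta> $ i\<bar> powr \<tau>" using i by simp
  ultimately show False
    using abs_entry_powr_le_ltau_pow[of \<eta> i \<tau>] by linarith
qed

lemma null_space_diff:
  assumes "u \<in> feasible_set \<Phi> y" "v \<in> feasible_set \<Phi> y"
  shows "u - v \<in> null_space \<Phi>"
  using assms by (simp add: feasible_set_def null_space_def matrix_vector_mult_diff_distrib)

text \<open>Replacing \<open>u\<close> by \<open>v\<close> costs at most the \<open>\<tau>\<close>-sum of \<open>u - v\<close> on the support of \<open>v\<close>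
  and saves its \<open>\<tau>\<close>-sum on the complement in full, of which the null space property
  lets the cost be at most the fraction \<open>\<gamma>\<close>.\<close>

lemma tau_NSP_sparse_ltau_gap:
  assumes "tau_NSP \<tau> \<Phi> K \<gamma>" "0 < \<tau>" "\<tau> \<le> 1"
    and "u \<in> feasible_set \<Phi> y" "v \<in> feasible_set \<Phi> y" "k_sparse K v"
  shows "ltau_pow \<tau> v + (1 - \<gamma>) * (\<Sum>i\<in>-{i. v $ i \<noteq> 0}. \<bar>(u - v) $ i\<bar> powr \<tau>) \<le> ltau_pow \<tau> u"
proof -
  define T where "T = {i. v $ i \<noteq> 0}"
  have nsp: "(\<Sum>i\<in>T. \<bar>(u - v) $ i\<bar> powr \<tau>) \<le> \<gamma> * (\<Sum>i\<in>-T. \<bar>(u - v) $ i\<bar> powr \<tau>)"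
    using assms by (intro tau_NSP_sum_le null_space_diff) (auto simp: k_sparse_def T_def)
  have "ltau_pow \<tau> v = (\<Sum>i\<in>T. \<bar>v $ i\<bar> powr \<tau>)"
    by (simp add: ltau_pow_split[of \<tau> v T] T_def)
  also have "\<dots> \<le> (\<Sum>i\<in>T. \<bar>u $ i\<bar> powr \<tau> + \<bar>(u - v) $ i\<bar> powr \<tau>)"
  proof (rule sum_mono)
    fix i
    have "\<bar>u $ i + (v - u) $ i\<bar> powr \<tau> \<le> \<bar>u $ i\<bar> powr \<tau> + \<bar>(v - u) $ i\<bar> powr \<tau>"
      using assms by (intro abs_powr_triangle) auto
    then show "\<bar>v $ i\<bar> powr \<tau> \<le> \<bar>u $ i\<bar> powr \<tau> + \<bar>(u - v) $ i\<bar> powr \<tau>"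
      by (simp add: abs_minus_commute)
  qed
  also have "\<dots> = (\<Sum>i\<in>T. \<bar>u $ i\<bar> powr \<tau>) + (\<Sum>i\<in>T. \<bar>(u - v) $ i\<bar> powr \<tau>)"
    by (rule sum.distrib)
  finally have "ltau_pow \<tau> v \<le> \<dots>" .
  moreover have "ltau_pow \<tau> u = (\<Sum>i\<in>T. \<bar>u $ i\<bar> powr \<tau>) + (\<Sum>i\<in>-T. \<bar>(u - v) $ i\<bar> powr \<tau>)"
    by (simp add: ltau_pow_split[of \<tau> u T] T_def)
  ultimately show ?thesis using nsp by (simp add: T_def algebra_simps)
qed

text \<open>Two sparse feasible vectors would each have the smaller \<open>\<tau>\<close>-sum: adding the two gap
  inequalities makes both gaps vanish.\<close>

lemma tau_NSP_sparse_unique: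
  assumes nsp: "tau_NSP \<tau> \<Phi> K \<gamma>" and "\<gamma> < 1" "0 < \<tau>" "\<tau> \<le> 1"
    and u: "u \<in> feasible_set \<Phi> y" "k_sparse K u" and v: "v \<in> feasible_set \<Phi> y" "k_sparse K v"
  shows "u = v"
proof -
  define T where "T = {i. v $ i \<noteq> 0}"
  define H where "H = (\<Sum>i\<in>-T. \<bar>(u - v) $ i\<bar> powr \<tau>)"
  define H' where "H' = (\<Sum>i\<in>-{i. u $ i \<noteq> 0}. \<bar>(v - u) $ i\<bar> powr \<tau>)"
  have "(1 - \<gamma>) * (H + H') \<le> 0"
    using tau_NSP_sparse_ltau_gap[OF nsp assms(3,4) u(1) v]
      tau_NSP_sparse_ltau_gap[OF nsp assms(3,4) v(1) u]
    by (simp add: H_def H'_def T_def algebra_simps)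
  moreover have "0 \<le> H" "0 \<le> H'" by (auto simp: H_def H'_def sum_nonneg)
  ultimately have "H = 0"
    using \<open>\<gamma> < 1\<close> by (smt (verit) mult_pos_pos)
  moreover have "(\<Sum>i\<in>T. \<bar>(u - v) $ i\<bar> powr \<tau>) \<le> \<gamma> * H"
    unfolding H_def using nsp u v by (intro tau_NSP_sum_le null_space_diff) (auto simp: k_sparse_def T_def)
  ultimately have "ltau_pow \<tau> (u - v) \<le> 0"
    using ltau_pow_split[of \<tau> "u - v" T] by (simp add: H_def)
  then have "\<bar>(u - v) $ i\<bar> powr \<tau> = 0" for i
    using abs_entry_powr_le_ltau_pow[of "u - v" i \<tau>]
    by (smt (verit) powr_ge_zero)
  then show ?thesis by (simp add: vec_eq_iff)
qed

section \<open>Weighted least squares on the feasible set\<close>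

text \<open>Positive weights make the sublevel sets compact, so \<open>arg_min\<close> picks a genuine minimiser.\<close>

lemma weighted_least_squares_minimizer:
  fixes w :: "real^'n" and \<Phi> :: "real^'n^'m"
  assumes w: "\<And>j. 0 < w $ j" and z0: "z0 \<in> feasible_set \<Phi> y"
  defines "f \<equiv> \<lambda>z :: real^'n. \<Sum>j\<in>UNIV. w $ j * (z $ j)\<^sup>2"
  shows "is_arg_min f (\<lambda>z. z \<in> feasible_set \<Phi> y) (arg_min f (\<lambda>z. z \<in> feasible_set \<Phi> y))"
proof -
  let ?S = "{z. \<Phi> *v z = y} \<inter> {z. f z \<le> f z0}"
  have cont: "continuous_on UNIV f" unfolding f_def by (intro continuous_intros)
  have "closed {z. \<Phi> *v z = y}"
    by (intro closed_Collect_eq continuous_intros linear_continuous_on_compose[OF continuous_on_id])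
      auto
  moreover have "closed {z. f z \<le> f z0}"
    using cont by (intro closed_Collect_le) auto
  ultimately have "closed ?S" by (rule closed_Int)
  \<comment> \<open>Each summand of \<open>f z\<close> is at most \<open>f z0\<close>, so positive weights bound every coordinate.\<close>
  moreover have "bounded ?S"
  proof -
    have "\<bar>z $ j\<bar> \<le> sqrt (f z0 / w $ j)" if "z \<in> ?S" for z j
    proof -
      have "w $ j * (z $ j)\<^sup>2 \<le> f z"
        unfolding f_def using w by (intro member_le_sum) (auto simp: less_imp_le)
      then have "(z $ j)\<^sup>2 \<le> f z0 / w $ j"
        using that w[of j] by (simp add: field_simps)
      then show ?thesis using real_sqrt_le_mono by fastforce
    qed
    then have "norm z \<le> (\<Sum>j\<in>UNIV. sqrt (f z0 / w $ j))" if "z \<in> ?S" for z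
      using that by (intro order_trans[OF norm_le_l1_cart] sum_mono) auto
    then show ?thesis unfolding bounded_iff by blast
  qed
  ultimately have "compact ?S" by (simp add: compact_eq_bounded_closed)
  moreover have "z0 \<in> ?S" using z0 by (simp add: feasible_set_def)
  ultimately obtain z where z: "z \<in> ?S" "\<And>u. u \<in> ?S \<Longrightarrow> f z \<le> f u"
    using continuous_attains_inf[of ?S f] cont continuous_on_subset by blast
  have "f z \<le> f u" if "u \<in> feasible_set \<Phi> y" for u
    using z that by (cases "f u \<le> f z0") (auto simp: feasible_set_def)
  then have "is_arg_min f (\<lambda>z. z \<in> feasible_set \<Phi> y) z"
    using z(1) by (auto simp: is_arg_min_linorder feasible_set_def)
  then show ?thesis unfolding arg_min_def by (rule someI)
qed

lemma quadratic_nonneg_imp_linear_coeff_0: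
  fixes b c :: real
  assumes "\<And>t. 0 \<le> 2 * t * b + t\<^sup>2 * c" "0 \<le> c"
  shows "b = 0"
proof -
  \<comment> \<open>The minimising step \<open>- b / c\<close> is damped to \<open>- b / (c + 1)\<close> because \<open>c\<close> may vanish.\<close>
  have "2 * (- b / (c + 1)) * b + (- b / (c + 1))\<^sup>2 * c = - (b\<^sup>2 * (c + 2)) / (c + 1)\<^sup>2"
    using assms(2) by (simp add: divide_simps power2_eq_square) (simp add: algebra_simps)
  then have "0 \<le> - (b\<^sup>2 * (c + 2)) / (c + 1)\<^sup>2" using assms(1)[of "- b / (c + 1)"] by simp
  then have "b\<^sup>2 * (c + 2) \<le> 0" using assms(2) by (auto simp: divide_le_0_iff)
  then show ?thesis using assms(2) by (simp add: mult_le_0_iff)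
qed

text \<open>The first-order condition along the line \<open>x + t \<eta>\<close>, which stays feasible.\<close>

lemma weighted_least_squares_orthogonal:
  fixes w :: "real^'n" and \<Phi> :: "real^'n^'m"
  assumes w: "\<And>j. 0 < w $ j"
    and min: "is_arg_min (\<lambda>z. \<Sum>j\<in>UNIV. w $ j * (z $ j)\<^sup>2) (\<lambda>z. z \<in> feasible_set \<Phi> y) x"
    and \<eta>: "\<eta> \<in> null_space \<Phi>"
  shows "(\<Sum>j\<in>UNIV. w $ j * x $ j * \<eta> $ j) = 0"
proof (rule quadratic_nonneg_imp_linear_coeff_0[where c = "\<Sum>j\<in>UNIV. w $ j * (\<eta> $ j)\<^sup>2"])
  fix t :: real
  have "x + t *\<^sub>R \<eta> \<in> feasible_set \<Phi> y"
    using min \<eta> by (simp add: is_arg_min_linorder feasible_set_def null_space_def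
        matrix_vector_right_distrib matrix_vector_mult_scaleR)
  then have "(\<Sum>j\<in>UNIV. w $ j * (x $ j)\<^sup>2) \<le> (\<Sum>j\<in>UNIV. w $ j * ((x + t *\<^sub>R \<eta>) $ j)\<^sup>2)"
    using min unfolding is_arg_min_linorder by blast
  also have "\<dots> = (\<Sum>j\<in>UNIV. w $ j * (x $ j)\<^sup>2 + (2 * t * (w $ j * x $ j * \<eta> $ j) + t\<^sup>2 * (w $ j * (\<eta> $ j)\<^sup>2)))"
    by (intro sum.cong) (auto simp: power2_eq_square algebra_simps)
  also have "\<dots> = (\<Sum>j\<in>UNIV. w $ j * (x $ j)\<^sup>2) + (2 * t * (\<Sum>j\<in>UNIV. w $ j * x $ j * \<eta> $ j)
      + t\<^sup>2 * (\<Sum>j\<in>UNIV. w $ j * (\<eta> $ j)\<^sup>2))"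
    by (simp add: sum.distrib sum_distrib_left)
  finally show "0 \<le> 2 * t * (\<Sum>j\<in>UNIV. w $ j * x $ j * \<eta> $ j) + t\<^sup>2 * (\<Sum>j\<in>UNIV. w $ j * (\<eta> $ j)\<^sup>2)"
    by simp
qed (use w in \<open>auto intro!: sum_nonneg simp: less_imp_le\<close>)

section \<open>One reweighted step\<close>

text \<open>Writing \<open>u = z + (u - z)\<close> in the orthogonality relation expresses the energy of \<open>u - z\<close>
  through the entries of \<open>z\<close>, which live on its support.\<close>

lemma weighted_energy_le_support_sum:
  fixes w u z :: "real^'n"
  assumes orth: "(\<Sum>j\<in>UNIV. w $ j * u $ j * (u - z) $ j) = 0"
    and w: "\<And>j. 0 < w $ j"
    and A: "\<And>j. z $ j \<noteq> 0 \<Longrightarrow> w $ j * \<bar>z $ j\<bar> \<le> A"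
  shows "(\<Sum>j\<in>UNIV. w $ j * ((u - z) $ j)\<^sup>2) \<le> A * (\<Sum>j\<in>{j. z $ j \<noteq> 0}. \<bar>(u - z) $ j\<bar>)"
proof -
  have "(\<Sum>j\<in>UNIV. w $ j * ((u - z) $ j)\<^sup>2)
      = (\<Sum>j\<in>UNIV. w $ j * u $ j * (u - z) $ j - w $ j * z $ j * (u - z) $ j)"
    by (intro sum.cong) (auto simp: power2_eq_square algebra_simps)
  also have "\<dots> = (\<Sum>j\<in>UNIV. - (w $ j * z $ j * (u - z) $ j))"
    unfolding sum_subtractf sum_negf using orth by simp
  also have "\<dots> = (\<Sum>j\<in>{j. z $ j \<noteq> 0}. - (w $ j * z $ j * (u - z) $ j))"
    by (rule sum.mono_neutral_right) auto
  also have "\<dots> \<le> (\<Sum>j\<in>{j. z $ j \<noteq> 0}. A * \<bar>(u - z) $ j\<bar>)"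
  proof (rule sum_mono)
    fix j assume j: "j \<in> {j. z $ j \<noteq> 0}"
    have "- (w $ j * z $ j * (u - z) $ j) \<le> \<bar>w $ j * z $ j * (u - z) $ j\<bar>" by simp
    also have "\<dots> = w $ j * \<bar>z $ j\<bar> * \<bar>(u - z) $ j\<bar>" using w[of j] by (simp add: abs_mult)
    also have "\<dots> \<le> A * \<bar>(u - z) $ j\<bar>" using A j by (intro mult_right_mono) auto
    finally show "- (w $ j * z $ j * (u - z) $ j) \<le> A * \<bar>(u - z) $ j\<bar>" .
  qed
  finally show ?thesis by (simp add: sum_distrib_left)
qed

text \<open>An entry of \<open>v\<close> within \<open>\<rho> r\<close> of an entry of size at least \<open>r\<close> cannot come
  near zero, so its weight is not large.\<close>

lemma weight_mult_entry_le:
  fixes r t s e \<tau> \<rho> :: real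
  assumes "0 < r" "r \<le> \<bar>t\<bar>" "\<bar>s - t\<bar> \<le> \<rho> * r" "0 < \<rho>" "\<rho> < 1" "0 < \<tau>" "\<tau> \<le> 1"
  shows "(s\<^sup>2 + e\<^sup>2) powr (- ((2 - \<tau>) / 2)) * \<bar>t\<bar> \<le> inverse (r powr (1 - \<tau>) * (1 - \<rho>) powr (2 - \<tau>))"
proof -
  define b where "b = (1 - \<rho>) * \<bar>t\<bar>"
  have t: "0 < \<bar>t\<bar>" and b: "0 < b" using assms by (auto simp: b_def)
  have "\<rho> * r \<le> \<rho> * \<bar>t\<bar>" using assms by (intro mult_left_mono) auto
  moreover have "\<bar>t\<bar> \<le> \<bar>s\<bar> + \<bar>s - t\<bar>" by simp
  ultimately have "b \<le> \<bar>s\<bar>" using assms(3) by (simp add: b_def left_diff_distrib)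
  then have "b\<^sup>2 \<le> s\<^sup>2" using b power_mono[of b "\<bar>s\<bar>" 2] by simp
  then have "b\<^sup>2 \<le> s\<^sup>2 + e\<^sup>2" by (simp add: add_increasing2)
  then have "(s\<^sup>2 + e\<^sup>2) powr (- ((2 - \<tau>) / 2)) \<le> (b\<^sup>2) powr (- ((2 - \<tau>) / 2))"
    using b assms by (intro powr_mono2') auto
  also have "\<dots> = b powr (- (2 - \<tau>))"
    using b square_powr_half[of b "- (2 - \<tau>)"] by (simp only: minus_divide_left abs_of_pos)
  finally have "(s\<^sup>2 + e\<^sup>2) powr (- ((2 - \<tau>) / 2)) * \<bar>t\<bar> \<le> b powr (- (2 - \<tau>)) * \<bar>t\<bar>"
    by (intro mult_right_mono) auto
  also have "\<dots> = (1 - \<rho>) powr (- (2 - \<tau>)) * (\<bar>t\<bar> powr (- (2 - \<tau>)) * \<bar>t\<bar> powr 1)"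
    using t assms by (simp add: b_def powr_mult)
  also have "\<dots> = (1 - \<rho>) powr (- (2 - \<tau>)) * \<bar>t\<bar> powr (- (1 - \<tau>))"
    by (simp only: powr_add[symmetric]) simp
  also have "\<dots> \<le> (1 - \<rho>) powr (- (2 - \<tau>)) * r powr (- (1 - \<tau>))"
    using assms by (intro mult_left_mono powr_mono2') auto
  also have "\<dots> = inverse (r powr (1 - \<tau>) * (1 - \<rho>) powr (2 - \<tau>))"
    by (simp add: powr_minus del: minus_diff_eq)
  finally show ?thesis .
qed

text \<open>Let \<open>H\<close> be the left-hand side, \<open>S\<close> the weighted energy and \<open>B\<close> the sum on the right.
  Hoelder's inequality gives \<open>H\<^sup>2 \<le> S\<^sup>\<tau> B\<^sup>2\<^sup>-\<^sup>\<tau>\<close>, while orthogonality and the null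
  space property give \<open>S\<^sup>\<tau> \<le> \<gamma> A\<^sup>\<tau> H\<close>. One factor \<open>H\<close> cancels.\<close>

lemma reweighted_off_support_le:
  fixes u v z :: "real^'n" and \<Phi> :: "real^'n^'m"
  assumes nsp: "tau_NSP \<tau> \<Phi> K \<gamma>" and \<tau>: "0 < \<tau>" "\<tau> \<le> 1"
    and u: "u \<in> feasible_set \<Phi> y" and z: "z \<in> feasible_set \<Phi> y" "k_sparse K z"
    and w: "w = (\<chi> j. ((v $ j)\<^sup>2 + e\<^sup>2) powr (- ((2 - \<tau>) / 2)))" and e: "0 < e"
    and orth: "(\<Sum>j\<in>UNIV. w $ j * u $ j * (u - z) $ j) = 0"
    and A: "\<And>j. z $ j \<noteq> 0 \<Longrightarrow> w $ j * \<bar>z $ j\<bar> \<le> A" "0 \<le> A"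
  shows "(\<Sum>j\<in>-{j. z $ j \<noteq> 0}. \<bar>(u - z) $ j\<bar> powr \<tau>)
    \<le> \<gamma> * A powr \<tau> * (\<Sum>j\<in>-{j. z $ j \<noteq> 0}. ((v $ j)\<^sup>2 + e\<^sup>2) powr (\<tau> / 2)) powr (2 - \<tau>)"
proof -
  define T where "T = {j. z $ j \<noteq> 0}"
  define S where "S = (\<Sum>j\<in>UNIV. w $ j * ((u - z) $ j)\<^sup>2)"
  define H where "H = (\<Sum>j\<in>-T. \<bar>(u - z) $ j\<bar> powr \<tau>)"
  define B where "B = (\<Sum>j\<in>-T. ((v $ j)\<^sup>2 + e\<^sup>2) powr (\<tau> / 2))"
  have w_pos: "0 < w $ j" for j using e by (simp add: w)
  have S0: "0 \<le> S" unfolding S_def using w_pos by (intro sum_nonneg) (auto simp: less_imp_le)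
  have H0: "0 \<le> H" unfolding H_def by (intro sum_nonneg) auto
  have \<gamma>: "0 < \<gamma>" using nsp by (simp add: tau_NSP_def)

  have "S \<le> A * (\<Sum>j\<in>T. \<bar>(u - z) $ j\<bar>)"
    unfolding S_def T_def using orth w_pos A(1) by (rule weighted_energy_le_support_sum)
  then have "S powr \<tau> \<le> (A * (\<Sum>j\<in>T. \<bar>(u - z) $ j\<bar>)) powr \<tau>"
    using S0 \<tau> by (intro powr_mono2) auto
  also have "\<dots> = A powr \<tau> * (\<Sum>j\<in>T. \<bar>(u - z) $ j\<bar>) powr \<tau>"
    by (rule powr_mult)
  also have "\<dots> \<le> A powr \<tau> * (\<Sum>j\<in>T. \<bar>(u - z) $ j\<bar> powr \<tau>)"
    using \<tau> by (intro mult_left_mono sum_powr_le) auto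
  also have "\<dots> \<le> A powr \<tau> * (\<gamma> * H)"
    unfolding H_def using nsp u z
    by (intro mult_left_mono tau_NSP_sum_le null_space_diff) (auto simp: k_sparse_def T_def)
  finally have S_le: "S powr \<tau> \<le> A powr \<tau> * (\<gamma> * H)" .

  have "H = (\<Sum>j\<in>-T. (w $ j * ((u - z) $ j)\<^sup>2) powr (\<tau> / 2)
      * (((v $ j)\<^sup>2 + e\<^sup>2) powr (\<tau> / 2)) powr (1 - \<tau> / 2))"
    unfolding H_def
  proof (rule sum.cong[OF refl])
    fix j
    have "w $ j powr (\<tau> / 2) * (((v $ j)\<^sup>2 + e\<^sup>2) powr (\<tau> / 2)) powr (1 - \<tau> / 2)
        = ((v $ j)\<^sup>2 + e\<^sup>2) powr (- ((2 - \<tau>) / 2) * (\<tau> / 2) + (\<tau> / 2) * (1 - \<tau> / 2))"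
      by (simp only: w vec_lambda_beta powr_powr powr_add)
    also have "- ((2 - \<tau>) / 2) * (\<tau> / 2) + (\<tau> / 2) * (1 - \<tau> / 2) = 0"
      by (simp add: field_simps)
    finally have 1: "w $ j powr (\<tau> / 2) * (((v $ j)\<^sup>2 + e\<^sup>2) powr (\<tau> / 2)) powr (1 - \<tau> / 2) = 1"
      using e by simp
    show "\<bar>(u - z) $ j\<bar> powr \<tau> = (w $ j * ((u - z) $ j)\<^sup>2) powr (\<tau> / 2)
        * (((v $ j)\<^sup>2 + e\<^sup>2) powr (\<tau> / 2)) powr (1 - \<tau> / 2)"
      using 1 square_powr_half[of "(u - z) $ j" \<tau>] w_pos[of j]
      by (subst powr_mult) (auto simp del: vector_minus_component simp: mult.commute mult.left_commute)
  qed
  also have "\<dots> \<le> (\<Sum>j\<in>-T. w $ j * ((u - z) $ j)\<^sup>2) powr (\<tau> / 2) * B powr (1 - \<tau> / 2)"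
    unfolding B_def using w_pos \<tau> by (intro Hoelder_powr_sum) (auto simp: less_imp_le)
  also have "\<dots> \<le> S powr (\<tau> / 2) * B powr (1 - \<tau> / 2)"
    unfolding S_def using w_pos \<tau>
    by (intro mult_right_mono powr_mono2 sum_mono2) (auto simp: less_imp_le intro!: sum_nonneg)
  finally have "H\<^sup>2 \<le> (S powr (\<tau> / 2) * B powr (1 - \<tau> / 2))\<^sup>2"
    using H0 by (intro power_mono) auto
  also have "\<dots> = S powr \<tau> * B powr (2 - \<tau>)"
  proof -
    have "(t powr p)\<^sup>2 = t powr (p + p)" for t p :: real
      by (simp only: power2_eq_square powr_add)
    then show ?thesis by (simp add: power_mult_distrib)
  qed
  also have "\<dots> \<le> A powr \<tau> * (\<gamma> * H) * B powr (2 - \<tau>)"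
    using S_le by (intro mult_right_mono) auto
  finally have "H * H \<le> H * (\<gamma> * A powr \<tau> * B powr (2 - \<tau>))"
    by (simp add: power2_eq_square mult_ac)
  then have "H \<le> \<gamma> * A powr \<tau> * B powr (2 - \<tau>)"
    using H0 \<gamma> by (cases "H = 0") (auto simp: mult_le_cancel_left)
  then show ?thesis by (simp add: H_def B_def T_def)
qed

text \<open>The regularisation parameter \<open>e\<close> is controlled by the \<open>(K + 1)\<close>-st largest entry of
  \<open>v\<close>, which a \<open>k\<close>-sparse \<open>z\<close> forces to be of the order of the error \<open>v - z\<close>.\<close>

lemma regularised_off_support_le:
  fixes v z :: "real^'n"
  assumes "k_sparse k z" "k \<le> K" "K < CARD('n)" "0 < \<tau>" "\<tau> \<le> 1"
    and e: "0 < e" "e \<le> rearr v (K + 1) / real CARD('n)"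
  shows "(\<Sum>j\<in>-{j. z $ j \<noteq> 0}. ((v $ j)\<^sup>2 + e\<^sup>2) powr (\<tau> / 2))
    \<le> ltau_pow \<tau> (v - z) + real CARD('n) powr (1 - \<tau>) / (real K + 1 - real k) * ltau_pow \<tau> (v - z)"
proof -
  define T where "T = {j. z $ j \<noteq> 0}"
  have "((v $ j)\<^sup>2 + e\<^sup>2) powr (\<tau> / 2) \<le> \<bar>(v - z) $ j\<bar> powr \<tau> + e powr \<tau>" if "j \<in> -T" for j
  proof -
    have "((v $ j)\<^sup>2 + e\<^sup>2) powr (\<tau> / 2) \<le> ((v $ j)\<^sup>2) powr (\<tau> / 2) + (e\<^sup>2) powr (\<tau> / 2)"
      using assms by (intro powr_add_le) auto
    then show ?thesis using that e by (simp add: square_powr_half T_def)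
  qed
  then have "(\<Sum>j\<in>-T. ((v $ j)\<^sup>2 + e\<^sup>2) powr (\<tau> / 2))
      \<le> (\<Sum>j\<in>-T. \<bar>(v - z) $ j\<bar> powr \<tau> + e powr \<tau>)"
    by (rule sum_mono)
  also have "\<dots> \<le> (\<Sum>j\<in>UNIV. \<bar>(v - z) $ j\<bar> powr \<tau> + e powr \<tau>)"
    by (intro sum_mono2) auto
  also have "\<dots> = ltau_pow \<tau> (v - z) + real CARD('n) * e powr \<tau>"
    by (simp add: ltau_pow_def sum.distrib)
  finally have 1: "(\<Sum>j\<in>-T. ((v $ j)\<^sup>2 + e\<^sup>2) powr (\<tau> / 2)) \<le> \<dots>" .
  have "real CARD('n) * e powr \<tau> \<le> real CARD('n) * (rearr v (K + 1) / real CARD('n)) powr \<tau>"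
    using assms by (intro mult_left_mono powr_mono2) auto
  also have "\<dots> = real CARD('n) powr (1 - \<tau>) * rearr v (K + 1) powr \<tau>"
    using assms rearr_nonneg[of "K + 1" v] by (simp add: powr_divide powr_diff)
  also have "\<dots> \<le> real CARD('n) powr (1 - \<tau>) * (ltau_pow \<tau> (v - z) / (real K + 1 - real k))"
    using rearr_powr_le_ltau_pow_diff[of k z K \<tau> v] assms
    by (intro mult_left_mono) (auto simp: le_divide_eq mult.commute)
  finally show ?thesis using 1 by (simp add: T_def)
qed

text \<open>In the constant, \<open>\<gamma> A\<^sup>\<tau>\<close> comes from the bound off the support, \<open>1 + \<gamma>\<close> from
  extending it to all coordinates by the null space property, and \<open>2\<^sup>1\<^sup>-\<^sup>\<tau>\<close> from splitting a sum under
  the power \<open>2 - \<tau>\<close> into the error itself and the contribution of \<open>e\<close>.\<close>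

lemma reweighted_step_error_le:
  fixes u v z :: "real^'n" and \<Phi> :: "real^'n^'m"
  assumes nsp: "tau_NSP \<tau> \<Phi> K \<gamma>" and \<tau>: "0 < \<tau>" "\<tau> \<le> 1"
    and k: "1 \<le> k" "k \<le> K" "K < CARD('n)"
    and u: "u \<in> feasible_set \<Phi> y"
    and z: "z \<in> feasible_set \<Phi> y" "k_sparse k z" "0 < rearr z k"
    and \<rho>: "0 < \<rho>" "\<rho> < 1" and near: "ltau_pow \<tau> (v - z) \<le> (\<rho> * rearr z k) powr \<tau>"
    and w: "w = (\<chi> j. ((v $ j)\<^sup>2 + e\<^sup>2) powr (- ((2 - \<tau>) / 2)))"
    and e: "0 < e" "e \<le> rearr v (K + 1) / real CARD('n)"
    and orth: "(\<Sum>j\<in>UNIV. w $ j * u $ j * (u - z) $ j) = 0"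
  defines "A \<equiv> inverse (rearr z k powr (1 - \<tau>) * (1 - \<rho>) powr (2 - \<tau>))"
  shows "ltau_pow \<tau> (u - z) \<le> 2 powr (1 - \<tau>) * \<gamma> * (1 + \<gamma>) * A powr \<tau> *
      (1 + (real CARD('n) powr (1 - \<tau>) / (real K + 1 - real k)) powr (2 - \<tau>))
      * ltau_pow \<tau> (v - z) powr (2 - \<tau>)"
proof -
  define T where "T = {j. z $ j \<noteq> 0}"
  define H where "H = (\<Sum>j\<in>-T. \<bar>(u - z) $ j\<bar> powr \<tau>)"
  define E where "E = ltau_pow \<tau> (v - z)"
  define c where "c = real CARD('n) powr (1 - \<tau>) / (real K + 1 - real k)"
  define B where "B = (\<Sum>j\<in>-T. ((v $ j)\<^sup>2 + e\<^sup>2) powr (\<tau> / 2))"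
  have \<gamma>: "0 < \<gamma>" using nsp by (simp add: tau_NSP_def)
  have E0: "0 \<le> E" by (simp add: E_def ltau_pow_nonneg)
  have c0: "0 \<le> c" using k by (simp add: c_def)
  have K_sparse: "k_sparse K z" using z k by (simp add: k_sparse_def)
  have weight: "w $ j * \<bar>z $ j\<bar> \<le> A" if "z $ j \<noteq> 0" for j
  proof -
    have "\<bar>(v - z) $ j\<bar> powr \<tau> \<le> (\<rho> * rearr z k) powr \<tau>"
      using abs_entry_powr_le_ltau_pow near by (rule order_trans)
    then have "\<bar>v $ j - z $ j\<bar> \<le> \<rho> * rearr z k"
      using \<tau> mult_pos_pos[OF \<rho>(1) z(3)]
        powr_less_mono2[of \<tau> "\<rho> * rearr z k" "\<bar>v $ j - z $ j\<bar>"]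
      by (cases "\<bar>v $ j - z $ j\<bar> \<le> \<rho> * rearr z k") auto
    moreover have "rearr z k \<le> \<bar>z $ j\<bar>"
      using z k that by (intro sparse_entries_ge_rearr) auto
    ultimately show ?thesis
      unfolding A_def w using z \<rho> \<tau> by (simp del: inverse_mult_distrib) (rule weight_mult_entry_le)
  qed
  have "0 \<le> A" by (simp add: A_def)
  have "B \<le> E + c * E"
    unfolding B_def T_def E_def c_def using z(2) k(2,3) \<tau> e by (rule regularised_off_support_le)
  then have "B powr (2 - \<tau>) \<le> (E + c * E) powr (2 - \<tau>)"
    using \<tau> by (intro powr_mono2) (auto simp: B_def intro!: sum_nonneg)
  also have "\<dots> \<le> 2 powr (2 - \<tau> - 1) * (E powr (2 - \<tau>) + (c * E) powr (2 - \<tau>))"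
    using E0 c0 \<tau> by (intro add_powr_le_convex) auto
  also have "\<dots> = 2 powr (1 - \<tau>) * (1 + c powr (2 - \<tau>)) * E powr (2 - \<tau>)"
    using E0 c0 by (simp add: powr_mult algebra_simps)
  finally have B_le: "B powr (2 - \<tau>) \<le> 2 powr (1 - \<tau>) * (1 + c powr (2 - \<tau>)) * E powr (2 - \<tau>)" .
  have "H \<le> \<gamma> * A powr \<tau> * B powr (2 - \<tau>)"
    unfolding H_def B_def T_def
    using nsp \<tau> u z(1) K_sparse w e(1) orth weight \<open>0 \<le> A\<close> by (rule reweighted_off_support_le)
  also have "\<dots> \<le> \<gamma> * A powr \<tau> * (2 powr (1 - \<tau>) * (1 + c powr (2 - \<tau>)) * E powr (2 - \<tau>))"
    using B_le \<gamma> by (intro mult_left_mono) auto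
  finally have H_le: "H \<le> \<dots>" .
  have "(\<Sum>j\<in>T. \<bar>(u - z) $ j\<bar> powr \<tau>) \<le> \<gamma> * H"
    unfolding H_def using nsp u z(1) K_sparse
    by (intro tau_NSP_sum_le null_space_diff) (auto simp: k_sparse_def T_def)
  then have "ltau_pow \<tau> (u - z) \<le> (1 + \<gamma>) * H"
    using ltau_pow_split[of \<tau> "u - z" T] by (simp add: H_def algebra_simps)
  also have "\<dots> \<le> (1 + \<gamma>) * (\<gamma> * A powr \<tau> * (2 powr (1 - \<tau>) * (1 + c powr (2 - \<tau>)) * E powr (2 - \<tau>)))"
    using H_le \<gamma> by (intro mult_left_mono) auto
  finally show ?thesis by (simp add: E_def c_def mult_ac)
qed

section \<open>The iteration\<close>

lemma irls_state_positive:
  fixes \<Phi> :: "real^'n^'m"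
  assumes "K < CARD('n)" "irls_state \<Phi> y K \<tau> n = (x, e, w)"
  shows "0 \<le> e \<and> (e \<noteq> 0 \<longrightarrow> (\<forall>j. 0 < w $ j))"
  using assms(2)
proof (induction n arbitrary: x e w)
  case (Suc n)
  obtain x0 e0 w0 where st: "irls_state \<Phi> y K \<tau> n = (x0, e0, w0)" by (metis prod_cases3)
  show ?case
  proof (cases "e0 = 0")
    case True
    then show ?thesis using Suc st by auto
  next
    case False
    have "0 \<le> e"
      using Suc.prems Suc.IH[OF st] st False assms(1)
      by (auto simp: Let_def intro!: divide_nonneg_nonneg rearr_nonneg)
    moreover have "w = (\<chi> j. ((x $ j)\<^sup>2 + e\<^sup>2) powr (- ((2 - \<tau>) / 2)))"
      using Suc.prems st False by (auto simp: Let_def)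
    ultimately show ?thesis
      by (auto simp: sum_power2_eq_zero_iff simp del: powr_minus)
  qed
qed auto

text \<open>What survives stopping: once \<open>e\<close> vanishes the iterate is \<open>K\<close>-sparse, and it stays
  feasible because it is repeated.\<close>

lemma irls_state_Suc_invariant:
  fixes \<Phi> :: "real^'n^'m"
  assumes K: "K < CARD('n)" and z: "z \<in> feasible_set \<Phi> y"
    and "irls_state \<Phi> y K \<tau> (Suc n) = (x, e, w)"
  shows "x \<in> feasible_set \<Phi> y \<and> e \<le> rearr x (K + 1) / real CARD('n) \<and> (e = 0 \<longrightarrow> k_sparse K x)
    \<and> w = (\<chi> j. ((x $ j)\<^sup>2 + e\<^sup>2) powr (- ((2 - \<tau>) / 2)))"
  using assms(3)
proof (induction n arbitrary: x e w)
  case 0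
  let ?f = "\<lambda>z :: real^'n. \<Sum>j\<in>UNIV. (\<chi> j. 1) $ j * (z $ j)\<^sup>2 :: real"
  have "is_arg_min ?f (\<lambda>z. z \<in> feasible_set \<Phi> y) (arg_min ?f (\<lambda>z. z \<in> feasible_set \<Phi> y))"
    using z by (intro weighted_least_squares_minimizer) auto
  then show ?case
    using 0 k_sparse_if_rearr_Suc_eq_0[OF K, of x]
    by (auto simp: Let_def is_arg_min_def min_def split: if_splits)
next
  case (Suc n)
  obtain x0 e0 w0 where st: "irls_state \<Phi> y K \<tau> (Suc n) = (x0, e0, w0)" by (metis prod_cases3)
  show ?case
  proof (cases "e0 = 0")
    case True
    then show ?thesis
      using Suc.prems Suc.IH[OF st] st by (auto simp del: irls_state.simps simp: irls_state.simps(2)[of _ _ _ _ "Suc n"])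
  next
    case False
    let ?f = "\<lambda>z :: real^'n. \<Sum>j\<in>UNIV. w0 $ j * (z $ j)\<^sup>2"
    have "is_arg_min ?f (\<lambda>z. z \<in> feasible_set \<Phi> y) (arg_min ?f (\<lambda>z. z \<in> feasible_set \<Phi> y))"
      using z irls_state_positive[OF K st] False by (intro weighted_least_squares_minimizer) auto
    then show ?thesis
      using Suc.prems st False k_sparse_if_rearr_Suc_eq_0[OF K, of x]
      by (auto simp del: irls_state.simps simp: irls_state.simps(2)[of _ _ _ _ "Suc n"] Let_def
          is_arg_min_def min_def split: if_splits)
  qed
qed

lemma irls_state_Suc_orthogonal:
  fixes \<Phi> :: "real^'n^'m"
  assumes K: "K < CARD('n)" and z: "z \<in> feasible_set \<Phi> y"
    and st: "irls_state \<Phi> y K \<tau> n = (x, e, w)" and e: "e \<noteq> 0" and \<eta>: "\<eta> \<in> null_space \<Phi>"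
  shows "(\<Sum>j\<in>UNIV. w $ j * irls \<Phi> y K \<tau> (Suc n) $ j * \<eta> $ j) = 0"
proof (rule weighted_least_squares_orthogonal[OF _ _ \<eta>])
  show w: "0 < w $ j" for j using irls_state_positive[OF K st] e by simp
  let ?f = "\<lambda>z :: real^'n. \<Sum>j\<in>UNIV. w $ j * (z $ j)\<^sup>2"
  have "irls \<Phi> y K \<tau> (Suc n) = arg_min ?f (\<lambda>z. z \<in> feasible_set \<Phi> y)"
    using st e by (simp add: irls_def Let_def)
  then show "is_arg_min ?f (\<lambda>z. z \<in> feasible_set \<Phi> y) (irls \<Phi> y K \<tau> (Suc n))"
    using weighted_least_squares_minimizer[OF w z] by simp
qed

theorem theorem7p9:
  fixes \<Phi> :: "real^'n^'m" and y :: "real^'m" and xstar :: "real^'n"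
    and x :: "nat \<Rightarrow> real^'n" and E :: "nat \<Rightarrow> real"
    and K k n0 :: nat and \<tau> \<gamma> \<rho> A \<mu> Rstar :: real
  assumes "CARD('m) < CARD('n)"
    and "rank \<Phi> = CARD('m)"
    and "0 < \<tau>" and "\<tau> \<le> 1"
    and "K \<ge> 1"
    and "0 < \<gamma>" and "\<gamma> < 1"
    and "tau_NSP \<tau> \<Phi> K \<gamma>"
    and "k \<ge> 1" and "k \<le> K"
    and "xstar \<in> feasible_set \<Phi> y"
    and "k_sparse k xstar"
    and "rearr xstar k > 0"
    and "\<And>n. x n = irls \<Phi> y K \<tau> n"
    and "\<And>n. E n = ltau_pow \<tau> (x n - xstar)"
    and "0 < \<rho>" and "\<rho> < 1"
    and "n0 \<ge> 1"
    and "Rstar = (\<rho> * rearr xstar k) powr \<tau>"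
    and "E n0 \<le> Rstar"
    and "A = inverse ((rearr xstar k) powr (1 - \<tau>) * (1 - \<rho>) powr (2 - \<tau>))"
    and "\<mu> = 2 powr (1 - \<tau>) * \<gamma> * (1 + \<gamma>) * A powr \<tau> *
           (1 + (real CARD('n) powr (1 - \<tau>) / (real K + 1 - real k)) powr (2 - \<tau>))"
    and "\<mu> * Rstar powr (1 - \<tau>) \<le> 1"
  shows "\<forall>n\<ge>n0. E (n + 1) \<le> \<mu> * E n powr (2 - \<tau>)"
proof -
  note \<tau> = assms(3,4) and nsp = assms(8) and z = assms(11,12,13)
    and x = assms(14) and E = assms(15) and \<rho> = assms(16,17) and R = assms(19)
  have K: "K < CARD('n)" using assms(1) nsp by (rule tau_NSP_order_less)
  have \<mu>0: "0 \<le> \<mu>"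
    unfolding assms(22) using \<open>0 < \<gamma>\<close> by (intro mult_nonneg_nonneg add_nonneg_nonneg) auto
  have E0: "0 \<le> E n" for n by (simp add: E ltau_pow_nonneg)
  have rate: "E (Suc n) \<le> \<mu> * E n powr (2 - \<tau>)" if n: "1 \<le> n" "E n \<le> Rstar" for n
  proof -
    obtain v e w where st: "irls_state \<Phi> y K \<tau> n = (v, e, w)" by (metis prod_cases3)
    have v: "x n = v" using st by (simp add: x irls_def)
    have inv: "v \<in> feasible_set \<Phi> y" "e \<le> rearr v (K + 1) / real CARD('n)"
      "e = 0 \<Longrightarrow> k_sparse K v" "w = (\<chi> j. ((v $ j)\<^sup>2 + e\<^sup>2) powr (- ((2 - \<tau>) / 2)))"
      using irls_state_Suc_invariant[OF K z(1), of \<tau> "n - 1" v e w] st n by auto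
    show ?thesis
    proof (cases "e = 0")
      case True
      \<comment> \<open>The algorithm has stopped, at a vector as sparse as uniqueness requires.\<close>
      have "v = xstar"
        using tau_NSP_sparse_unique[OF nsp _ \<tau> inv(1) inv(3)[OF True] z(1)] assms(7,10) z(2)
        by (simp add: k_sparse_def)
      moreover have "x (Suc n) = v" using st True by (simp add: x irls_def)
      ultimately show ?thesis using \<mu>0 by (simp add: E ltau_pow_0)
    next
      case False
      then have e: "0 < e" using irls_state_positive[OF K st] by simp
      obtain u e' w' where st': "irls_state \<Phi> y K \<tau> (Suc n) = (u, e', w')" by (metis prod_cases3)
      have u: "x (Suc n) = u" using st' by (simp add: x irls_def)
      have uf: "u \<in> feasible_set \<Phi> y"
        using irls_state_Suc_invariant[OF K z(1) st'] by simp
      have "(\<Sum>j\<in>UNIV. w $ j * u $ j * (u - xstar) $ j) = 0"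
        using irls_state_Suc_orthogonal[OF K z(1) st False null_space_diff[OF uf z(1)]] u
        by (simp add: x)
      from reweighted_step_error_le[OF nsp \<tau> assms(9,10) K uf z \<rho> _ inv(4) e inv(2) this]
      show ?thesis using n(2) unfolding E u v R assms(21,22) by simp
    qed
  qed
  \<comment> \<open>The one-step bound needs the error to be at most \<open>Rstar\<close>, so it has to preserve this.\<close>
  have stay: "E n \<le> Rstar" if "n0 \<le> n" for n
    using that
  proof (induction n rule: dec_induct)
    case base
    show ?case by (rule assms(20))
  next
    case (step n)
    have "E (Suc n) \<le> \<mu> * E n powr (2 - \<tau>)"
      using step assms(18) by (intro rate) auto
    also have "\<dots> = \<mu> * E n powr (1 - \<tau>) * E n"
      using E0[of n] by (cases "E n = 0") (auto simp: powr_diff power2_eq_square powr_numeral)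
    also have "\<dots> \<le> \<mu> * Rstar powr (1 - \<tau>) * E n"
      using \<mu>0 E0[of n] step.IH \<tau> by (intro mult_right_mono mult_left_mono powr_mono2) auto
    also have "\<dots> \<le> 1 * E n"
      using assms(23) E0[of n] by (rule mult_right_mono)
    finally show ?case using step.IH by simp
  qed
  show ?thesis
  proof (intro allI impI)
    fix n assume "n0 \<le> n"
    then show "E (n + 1) \<le> \<mu> * E n powr (2 - \<tau>)"
      using rate[of n] stay[of n] assms(18) by simp
  qed
qed

end
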